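(* Let $m\in\mathcal{P}(X)$. Assume that: $g$ is bounded; $f$ is convex and differentiable with $\nabla f$ Lipschitz continuous with constant $L$; for every $\lambda\in\mathrm{dom}(f^* )$, $g_\lambda$ is lower semi-continuous on $Z$, $G_\lambda$ is a lower semi-continuous set-valued map and $\mathrm{BR}_\lambda(x)\ne\emptyset$ for all $x\in X$. Assume moreover that: $X$ is a closed subset of a separable Banach space; $g\colon Z\to\mathcal{H}$ is continuous; $Z_x$ is compact for every $x\in X$ and $F$ is upper semi-continuous; and there is $L_g\ge0$ such that $\mathcal{Z}\colon X\rightsquigarrow\mathcal{H}$, $\mathcal{Z}(x)=\{g(x,y):y\in Z_x\}$, is $L_g$-Lipschitz. Assume that the set $G_m:=\{\int_Z g\,d\mu:\mu\in\mathcal{P}_m(Z)\}\subseteq\mathcal{H}$ is closed. Then: (1) $\mathrm{val}(\mathrm{P}_m)=\mathrm{val}(\mathrm{D}_m)$; (2) the primal problem $(\mathrm{P}_m)$ has a solution; (3) if $\lambda^*(m)$ is the solution of $(\mathrm{D}_m)$ and $\mu$ is a solution of $(\mathrm{P}_m)$, then $\lambda^*(m)=\nabla f\left(\int_Z g\,d\mu\right)$.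
   Context: $X$ and $Y$ are complete separable metric spaces with metrics $d_X,d_Y$ and Borel $\sigma$-algebras; $\mathcal{P}(\cdot)$ denotes the set of Borel probability measures. $F\colon X\rightsquigarrow Y$ is a set-valued map with non-empty values and closed graph; $Z_x:=F(x)$, $Z:=\{(x,y): y\in Z_x\}\subseteq X\times Y$. $\mathcal{H}$ is a separable real Hilbert space; $g\colon Z\to\mathcal{H}$, $f\colon\mathcal{H}\to\mathbb{R}$ are Borel measurable. With $\pi_1(x,y)=x$, $\mathcal{P}_m(Z)=\{\mu\in\mathcal{P}(Z):\pi_1\#\mu=m\}$. The primal problem $(\mathrm{P}_m)$ is $\inf_{\mu\in\mathcal{P}_m(Z)}f(\int_Z g\,d\mu)$ (Bochner integral). For $\lambda\in\mathcal{H}$: $g_\lambda(x,y)=\langle\lambda,g(x,y)\rangle$, $u_\lambda(x)=\inf_{y\in Z_x}g_\lambda(x,y)$, $G_\lambda(x)=\{g_\lambda(x,y):y\in Z_x\}\subseteq\mathbb{R}$, $\mathrm{BR}_\lambda(x)=\operatorname{argmin}_{y\in Z_x}g_\lambda(x,y)$. $f^*(\lambda)=\sup_{\beta\in\mathcal{H}}(\langle\lambda,\beta\rangle-f(\beta))$ is the Fenchel conjugate and $\mathrm{dom}(f^* )=\{f^*<+\infty\}$. Dual problem $(\mathrm{D}_m)$: $-\inf_{\lambda\in\mathrm{dom}(f^* )}\mathcal{D}_m(\lambda)$ where $\mathcal{D}_m(\lambda)=f^*(\lambda)-\int_X u_\lambda\,dm$; thus $\mathrm{val}(\mathrm{D}_m)=-\inf\mathcal{D}_m$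 and a solution of $(\mathrm{D}_m)$ is a minimizer of $\mathcal{D}_m$ over $\mathrm{dom}(f^* )$. Under the assumptions it has a unique solution, denoted $\lambda^*(m)$. Set-valued maps $\Phi$ (non-empty values): lower semi-continuous if for every $x$, $y\in\Phi(x)$ and $x_n\to x$ there are $y_n\in\Phi(x_n)$ with $y_n\to y$; upper semi-continuous if for every $x$ and every neighborhood $\mathcal{U}$ of $\Phi(x)$ there is $\eta>0$ with $\Phi(x')\subseteq\mathcal{U}$ whenever $d_X(x,x')\le\eta$; $\mathcal{Z}$ is $L_g$-Lipschitz if $\mathcal{Z}(x_1)\subseteq\mathcal{Z}(x_2)+B_{\mathcal{H}}(0,L_g d_X(x_1,x_2))$ for all $x_1,x_2\in X$ (closed ball). *)

theory Defs
  imports "HOL-Probability.Probability"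
begin

text \<open>
  The space \<open>X\<close> is a closed subset, with the induced metric, of a separable Banach space given as
  a type; \<open>Y\<close> is a whole type. The graph \<open>Z\<close> of a set-valued map \<open>F\<close> is \<open>Sigma X F\<close>, so only the
  values of \<open>F\<close> on \<open>X\<close> matter.
\<close>


section \<open>Borel probability measures\<close>

definition borel_probs :: "'a::topological_space set \<Rightarrow> 'a measure set" where
  "borel_probs S = space (prob_algebra (restrict_space borel S))"

definition probs_with_marginal ::
  "'x::topological_space set \<Rightarrow> ('x \<Rightarrow> 'y::topological_space set) \<Rightarrow> 'x measure
    \<Rightarrow> ('x \<times> 'y) measure set" where
  "probs_with_marginal X F m =
     {\<mu> \<in> borel_probs (Sigma X F). distr \<mu> (restrict_space borel X) fst = m}"


section \<open>Semicontinuity and Lipschitz continuity of functions and set-valued maps\<close>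

definition lsc_function_on :: "'a::topological_space set \<Rightarrow> ('a \<Rightarrow> real) \<Rightarrow> bool" where
  "lsc_function_on S h \<longleftrightarrow> (\<forall>z\<in>S. \<forall>a < h z. eventually (\<lambda>z'. a < h z') (at z within S))"

definition lsc_map_on ::
  "'a::metric_space set \<Rightarrow> ('a \<Rightarrow> 'b::topological_space set) \<Rightarrow> bool" where
  "lsc_map_on X \<Phi> \<longleftrightarrow>
     (\<forall>x\<in>X. \<forall>y\<in>\<Phi> x. \<forall>s. (\<forall>n. s n \<in> X) \<and> s \<longlonglongrightarrow> x \<longrightarrow>
        (\<exists>t. (\<forall>n. t n \<in> \<Phi> (s n)) \<and> t \<longlonglongrightarrow> y))"

definition usc_map_on ::
  "'a::metric_space set \<Rightarrow> ('a \<Rightarrow> 'b::topological_space set) \<Rightarrow> bool" where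
  "usc_map_on X \<Phi> \<longleftrightarrow>
     (\<forall>x\<in>X. \<forall>U. \<Phi> x \<subseteq> interior U \<longrightarrow>
        (\<exists>\<eta>>0. \<forall>x'\<in>X. dist x x' \<le> \<eta> \<longrightarrow> \<Phi> x' \<subseteq> U))"

definition lipschitz_map_on ::
  "real \<Rightarrow> 'a::metric_space set \<Rightarrow> ('a \<Rightarrow> 'b::real_normed_vector set) \<Rightarrow> bool" where
  "lipschitz_map_on C X \<Phi> \<longleftrightarrow>
     (\<forall>x1\<in>X. \<forall>x2\<in>X. \<Phi> x1 \<subseteq> {v + w | v w. v \<in> \<Phi> x2 \<and> w \<in> cball 0 (C * dist x1 x2)})"


section \<open>Fenchel conjugate and gradient\<close>

definition fenchel_conjugate :: "('h::real_inner \<Rightarrow> real) \<Rightarrow> 'h \<Rightarrow> ereal" where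
  "fenchel_conjugate f l = (SUP b. ereal (inner l b - f b))"

definition conjugate_domain :: "('h::real_inner \<Rightarrow> real) \<Rightarrow> 'h set" where
  "conjugate_domain f = {l. fenchel_conjugate f l < \<infinity>}"

text \<open>
  On a Hilbert space this is the Riesz representative of the Frechet derivative. The value is
  unspecified where \<open>f\<close> is not differentiable.
\<close>

definition gradient :: "('h::real_inner \<Rightarrow> real) \<Rightarrow> 'h \<Rightarrow> 'h" where
  "gradient f b = (THE D. GDERIV f b :> D)"

lemma gradient_eqI:
  assumes "GDERIV f b :> D"
  shows "gradient f b = D"
  unfolding gradient_def
proof (rule the_equality[where P = "\<lambda>D. GDERIV f b :> D", OF assms])
  fix D' assume "GDERIV f b :> D'"
  with assms have "(\<lambda>h. inner h D') = (\<lambda>h. inner h D)"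
    unfolding gderiv_def by (rule has_derivative_unique[rotated])
  then have "inner (D' - D) (D' - D) = 0"
    by (metis inner_diff_right diff_self)
  then show "D' = D" by simp
qed


section \<open>Primal and dual problems\<close>

definition scalarized :: "('z \<Rightarrow> 'h::real_inner) \<Rightarrow> 'h \<Rightarrow> 'z \<Rightarrow> real" where
  "scalarized g l z = inner l (g z)"

text \<open>
  The infimum is taken in the reals; it is the true infimum because the statement assumes \<open>g\<close>
  bounded on \<open>Sigma X F\<close> and \<open>F\<close> non-empty-valued on \<open>X\<close>.
\<close>

definition lower_value ::
  "('x \<Rightarrow> 'y set) \<Rightarrow> ('x \<times> 'y \<Rightarrow> 'h::real_inner) \<Rightarrow> 'h \<Rightarrow> 'x \<Rightarrow> real" where
  "lower_value F g l x = (INF y\<in>F x. scalarized g l (x, y))"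

definition best_responses ::
  "('x \<Rightarrow> 'y set) \<Rightarrow> ('x \<times> 'y \<Rightarrow> 'h::real_inner) \<Rightarrow> 'h \<Rightarrow> 'x \<Rightarrow> 'y set" where
  "best_responses F g l x =
     {y. is_arg_min (\<lambda>y. scalarized g l (x, y)) (\<lambda>y. y \<in> F x) y}"

definition aggregates ::
  "'x::topological_space set \<Rightarrow> ('x \<Rightarrow> 'y::topological_space set)
    \<Rightarrow> ('x \<times> 'y \<Rightarrow> 'h::{real_inner, banach, second_countable_topology}) \<Rightarrow> 'x measure \<Rightarrow> 'h set" where
  "aggregates X F g m = {(\<integral>z. g z \<partial>\<mu>) | \<mu>. \<mu> \<in> probs_with_marginal X F m}"

definition primal_value ::
  "'x::topological_space set \<Rightarrow> ('x \<Rightarrow> 'y::topological_space set)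
    \<Rightarrow> ('x \<times> 'y \<Rightarrow> 'h::{real_inner, banach, second_countable_topology}) \<Rightarrow> ('h \<Rightarrow> real)
    \<Rightarrow> 'x measure \<Rightarrow> ereal" where
  "primal_value X F g f m = (INF \<mu>\<in>probs_with_marginal X F m. ereal (f (\<integral>z. g z \<partial>\<mu>)))"

definition primal_solution ::
  "'x::topological_space set \<Rightarrow> ('x \<Rightarrow> 'y::topological_space set)
    \<Rightarrow> ('x \<times> 'y \<Rightarrow> 'h::{real_inner, banach, second_countable_topology}) \<Rightarrow> ('h \<Rightarrow> real)
    \<Rightarrow> 'x measure \<Rightarrow> ('x \<times> 'y) measure \<Rightarrow> bool" where
  "primal_solution X F g f m =
     is_arg_min (\<lambda>\<mu>. f (\<integral>z. g z \<partial>\<mu>)) (\<lambda>\<mu>. \<mu> \<in> probs_with_marginal X F m)"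

definition dual_objective ::
  "('x \<Rightarrow> 'y set) \<Rightarrow> ('x \<times> 'y \<Rightarrow> 'h::real_inner) \<Rightarrow> ('h \<Rightarrow> real) \<Rightarrow> 'x measure \<Rightarrow> 'h \<Rightarrow> ereal" where
  "dual_objective F g f m l = fenchel_conjugate f l - ereal (\<integral>x. lower_value F g l x \<partial>m)"

definition dual_value ::
  "('x \<Rightarrow> 'y set) \<Rightarrow> ('x \<times> 'y \<Rightarrow> 'h::real_inner) \<Rightarrow> ('h \<Rightarrow> real) \<Rightarrow> 'x measure \<Rightarrow> ereal" where
  "dual_value F g f m = - (INF l\<in>conjugate_domain f. dual_objective F g f m l)"

definition dual_solution ::
  "('x \<Rightarrow> 'y set) \<Rightarrow> ('x \<times> 'y \<Rightarrow> 'h::real_inner) \<Rightarrow> ('h \<Rightarrow> real) \<Rightarrow> 'x measure \<Rightarrow> 'h \<Rightarrow> bool" where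
  "dual_solution F g f m =
     is_arg_min (dual_objective F g f m) (\<lambda>l. l \<in> conjugate_domain f)"

end

theory Submission
  imports Defs
begin

text \<open>
  The set \<open>K\<close> of aggregates is convex, bounded and closed, so the convex function \<open>f\<close> attains its
  minimum over \<open>K\<close> at some \<open>b\<close>. The gradient \<open>l\<close> of \<open>f\<close> at \<open>b\<close> satisfies \<open>inner (b' - b) l \<ge> 0\<close> on \<open>K\<close>,
  while a measurable selection of best responses shows that the minimum of \<open>inner l\<close> over \<open>K\<close> is the
  integral of \<open>lower_value F g l\<close>. With the equality case of Fenchel--Young this gives the dual
  objective at \<open>l\<close> the value \<open>- f b\<close>, which weak duality makes minimal. Conversely, a primal and a
  dual solution force equality in Fenchel--Young, so the dual one is a subgradient, hence the gradient.
\<close>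

section \<open>Convexity and gradients in Hilbert space\<close>

text \<open>Stands in for weak compactness. Points \<open>x n\<close> of nearly minimal norm in
  \<open>S n\<close> form a Cauchy sequence by the parallelogram law, and closedness puts their
  limit in every \<open>S k\<close>. Boundedness of \<open>S 0\<close> is what makes the increasing
  distances \<open>d n\<close> to the origin converge.\<close>

lemma nested_closed_convex_bounded_nonempty:
  fixes S :: "nat \<Rightarrow> 'a::{real_inner, banach} set"
  assumes closed: "\<And>n. closed (S n)" and convex: "\<And>n. convex (S n)"
    and ne: "\<And>n. S n \<noteq> {}" and dec: "decseq S" and bdd: "bounded (S 0)"
  shows "(\<Inter>n. S n) \<noteq> {}"
proof -
  define d where "d n = (INF v\<in>S n. norm v)" for n
  have bdd_below: "bdd_below (norm ` S n)" for n
    by (rule bdd_belowI2[of _ 0]) simp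
  have d_le: "d n \<le> norm v" if "v \<in> S n" for n v
    unfolding d_def using bdd_below that by (rule cINF_lower)
  have "\<exists>v\<in>S n. norm v < d n + inverse (real (Suc n))" for n
    using cInf_lessD[of "norm ` S n" "d n + inverse (real (Suc n))"] ne by (auto simp: d_def)
  then obtain x where x: "\<And>n. x n \<in> S n" "\<And>n. norm (x n) < d n + inverse (real (Suc n))"
    by metis
  have sub: "S n \<subseteq> S k" if "k \<le> n" for k n
    using dec that by (auto simp: decseq_def)
  have "incseq d"
    unfolding incseq_def d_def using sub ne bdd_below by (auto intro!: cINF_superset_mono)
  obtain B where B: "\<And>v. v \<in> S 0 \<Longrightarrow> norm v \<le> B"
    using bdd by (auto simp: bounded_iff)
  have "d n \<le> B" for n
    using d_le[OF x(1)] B sub[of 0 n] x(1)[of n] by (meson le0 order_trans subsetD)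
  then obtain D where D: "d \<longlonglongrightarrow> D"
    using incseq_convergent[OF \<open>incseq d\<close>] by metis
  have "(\<lambda>n. norm (x n)) \<longlonglongrightarrow> D"
  proof (rule tendsto_sandwich[OF _ _ D])
    show "(\<lambda>n. d n + inverse (real (Suc n))) \<longlonglongrightarrow> D"
      using tendsto_add[OF D LIMSEQ_inverse_real_of_nat] by simp
  qed (use d_le x in \<open>auto intro!: always_eventually intro: less_imp_le\<close>)
  then have lim_x: "(\<lambda>n. (norm (x n))\<^sup>2) \<longlonglongrightarrow> D\<^sup>2" and lim_d: "(\<lambda>n. (d n)\<^sup>2) \<longlonglongrightarrow> D\<^sup>2"
    using D by (auto intro: tendsto_power)
  have d_nonneg: "0 \<le> d n" for n
    unfolding d_def using ne by (auto intro!: cINF_greatest)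
  \<comment> \<open>Parallelogram identity: both points lie in the convex set \<open>S q\<close>, so
    their midpoint does too and has norm at least \<open>d q\<close>.\<close>
  have key: "(norm (x p - x q))\<^sup>2 \<le> 2 * (norm (x p))\<^sup>2 + 2 * (norm (x q))\<^sup>2 - 4 * (d q)\<^sup>2"
    if "q \<le> p" for p q
  proof -
    have "(1/2) *\<^sub>R x p + (1/2) *\<^sub>R x q \<in> S q"
      using convexD[OF convex, of "x p" q "x q" "1/2" "1/2"] x(1) sub[OF that] by auto
    then have "d q \<le> norm ((1/2) *\<^sub>R (x p + x q))"
      using d_le by (metis scaleR_add_right)
    then have "2 * d q \<le> norm (x p + x q)"
      by simp
    then have "4 * (d q)\<^sup>2 \<le> (norm (x p + x q))\<^sup>2"
      using d_nonneg[of q] power_mono[of "2 * d q" _ 2] by (simp add: power_mult_distrib)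
    then show ?thesis
      by (simp add: power2_norm_eq_inner inner_simps inner_commute)
  qed
  have "Cauchy x"
  proof (rule metric_CauchyI)
    fix e :: real assume "0 < e"
    then have e: "D\<^sup>2 < D\<^sup>2 + e\<^sup>2 / 16" "D\<^sup>2 - e\<^sup>2 / 16 < D\<^sup>2" by simp_all
    \<comment> \<open>With these tolerances the bound in \<open>key\<close> is below
      \<open>e\<^sup>2 / 2\<close>: the terms in \<open>D\<^sup>2\<close> cancel, and eight errors
      of \<open>e\<^sup>2 / 16\<close> remain.\<close>
    obtain N where N: "\<And>n. n \<ge> N \<Longrightarrow> (norm (x n))\<^sup>2 < D\<^sup>2 + e\<^sup>2 / 16"
      "\<And>n. n \<ge> N \<Longrightarrow> D\<^sup>2 - e\<^sup>2 / 16 < (d n)\<^sup>2"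
      using eventually_conj[OF order_tendstoD(2)[OF lim_x e(1)] order_tendstoD(1)[OF lim_d e(2)]]
      by (auto simp: eventually_sequentially)
    have less: "dist (x p) (x q) < e" if "N \<le> q" "q \<le> p" for p q
    proof -
      have "(norm (x p - x q))\<^sup>2 < e\<^sup>2"
        using key[OF \<open>q \<le> p\<close>] N(1)[OF order_trans[OF that]] N(1)[OF that(1)] N(2)[OF that(1)] e(1)
        by linarith
      then show ?thesis
        using \<open>0 < e\<close> by (auto simp: dist_norm intro: power2_less_imp_less)
    qed
    show "\<exists>M. \<forall>p\<ge>M. \<forall>q\<ge>M. dist (x p) (x q) < e"
      using less by (metis dist_commute nle_le)
  qed
  then obtain l where l: "x \<longlonglongrightarrow> l"
    by (auto simp: Cauchy_convergent_iff convergent_def)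
  have "l \<in> S k" for k
  proof (rule Lim_in_closed_set[OF closed _ _ l])
    show "\<forall>\<^sub>F n in sequentially. x n \<in> S k"
      using x(1) sub by (auto simp: eventually_sequentially intro!: exI[of _ k])
  qed simp
  then show ?thesis by auto
qed

text \<open>The sublevel sets of \<open>f\<close> slightly above its infimum are closed, convex and
  nested, so they share a point, whose value cannot exceed the infimum.\<close>

lemma convex_continuous_attains_inf:
  fixes f :: "'a::{real_inner, banach} \<Rightarrow> real"
  assumes "closed K" "convex K" "bounded K" "K \<noteq> {}"
    and f: "convex_on K f" "continuous_on K f" "bdd_below (f ` K)"
  shows "\<exists>b\<in>K. \<forall>b'\<in>K. f b \<le> f b'"
proof -
  define I where "I = (INF b\<in>K. f b)"
  define S where "S n = {b \<in> K. f b \<le> I + inverse (real (Suc n))}" for n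
  have "(\<Inter>n. S n) \<noteq> {}"
  proof (rule nested_closed_convex_bounded_nonempty)
    fix n
    show "closed (S n)"
      unfolding S_def using f(2) \<open>closed K\<close>
      by (intro continuous_on_closed_Collect_le continuous_on_const)
    show "convex (S n)"
    proof (rule convexI)
      fix x y and u v :: real
      assume xy: "x \<in> S n" "y \<in> S n" and uv: "0 \<le> u" "0 \<le> v" "u + v = 1"
      have "f (u *\<^sub>R x + v *\<^sub>R y) \<le> u * f x + v * f y"
        using f(1) xy uv unfolding convex_on_def S_def by blast
      also have "\<dots> \<le> u * (I + inverse (real (Suc n))) + v * (I + inverse (real (Suc n)))"
        using xy uv by (intro add_mono mult_left_mono) (auto simp: S_def)
      also have "\<dots> = I + inverse (real (Suc n))"
        using uv(3) by (metis distrib_right mult_1)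
      finally show "u *\<^sub>R x + v *\<^sub>R y \<in> S n"
        using convexD[OF \<open>convex K\<close>, of x y u v] xy uv by (simp add: S_def)
    qed
    show "S n \<noteq> {}"
      using cInf_lessD[of "f ` K" "I + inverse (real (Suc n))"] \<open>K \<noteq> {}\<close>
      by (auto simp: S_def I_def intro: less_imp_le)
    show "bounded (S 0)"
      using \<open>bounded K\<close> by (rule bounded_subset) (auto simp: S_def)
  next
    show "decseq S"
      unfolding decseq_def
    proof (intro allI impI subsetI)
      fix p q x assume "p \<le> q" "x \<in> S q"
      moreover from this have "inverse (real (Suc q)) \<le> inverse (real (Suc p))"
        by (intro le_imp_inverse_le) auto
      ultimately show "x \<in> S p"
        unfolding S_def mem_Collect_eq by linarith
    qed
  qed
  then obtain b where b: "\<And>n. b \<in> S n" by auto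
  have "f b \<le> I"
    using LIMSEQ_le_const[OF LIMSEQ_inverse_real_of_nat_add[of I]] b by (auto simp: S_def)
  then show ?thesis
    using b[of 0] cINF_lower[OF f(3)] unfolding I_def S_def by (auto intro: order_trans)
qed

text \<open>The representing vector is a multiple of the minimal-norm point of \<open>{v. \<phi> v = 1}\<close>.\<close>

lemma riesz_representation:
  fixes \<phi> :: "'a::{real_inner, banach} \<Rightarrow> real"
  assumes "bounded_linear \<phi>"
  shows "\<exists>D. \<forall>h. \<phi> h = inner h D"
proof (cases "\<forall>h. \<phi> h = 0")
  case True
  then show ?thesis by (intro exI[of _ 0]) simp
next
  case False
  interpret bounded_linear \<phi> by fact
  obtain h0 where h0: "\<phi> h0 \<noteq> 0" using False by auto
  define w where "w = h0 /\<^sub>R \<phi> h0"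
  have w: "\<phi> w = 1" using h0 by (simp add: w_def scaleR)
  \<comment> \<open>The hyperplane is cut by a ball to make it bounded. The radius keeps
    \<open>w\<close> inside, and every discarded point has norm larger than \<open>norm w\<close>,
    so minimality over \<open>K\<close> extends to the whole hyperplane.\<close>
  define K where "K = {v. \<phi> v = 1} \<inter> cball 0 (norm w)"
  have "closed {v. \<phi> v = 1}"
    by (intro closed_Collect_eq continuous_on continuous_on_id continuous_on_const)
  moreover have "convex {v. \<phi> v = 1}"
    by (auto simp: convex_def add scaleR)
  moreover have "convex_on K norm"
    using convex_on_dist[of K 0] \<open>convex {v. \<phi> v = 1}\<close> by (simp add: K_def convex_Int)
  ultimately have "\<exists>v\<in>K. \<forall>v'\<in>K. norm v \<le> norm v'"
    using w by (intro convex_continuous_attains_inf)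
      (auto simp: K_def intro!: convex_Int closed_Int bounded_Int continuous_intros bdd_belowI2[of _ 0])
  then obtain v where v: "v \<in> K" "\<And>v'. v' \<in> K \<Longrightarrow> norm v \<le> norm v'" by auto
  have min: "norm v \<le> norm v'" if "\<phi> v' = 1" for v'
    using v that by (cases "norm v' \<le> norm w") (auto simp: K_def)
  have \<phi>v: "\<phi> v = 1" using v by (simp add: K_def)
  have orth: "inner k v = 0" if "\<phi> k = 0" for k
  proof (cases "k = 0")
    case False
    \<comment> \<open>This \<open>t\<close> minimizes the norm of \<open>v - t *\<^sub>R k\<close>,
      a point that stays in the hyperplane because \<open>k\<close> is in the kernel.\<close>
    define t where "t = inner k v / inner k k"
    have "\<phi> (v - t *\<^sub>R k) = 1" using that \<phi>v by (simp add: diff scaleR)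
    then have "(norm v)\<^sup>2 \<le> (norm (v - t *\<^sub>R k))\<^sup>2"
      by (intro power_mono min) auto
    also have "\<dots> = (norm v)\<^sup>2 - 2 * t * inner k v + t\<^sup>2 * inner k k"
      unfolding power2_norm_eq_inner
      by (simp add: inner_simps inner_commute power2_eq_square algebra_simps)
    also have "\<dots> = (norm v)\<^sup>2 - (inner k v)\<^sup>2 / inner k k"
      using False by (simp add: t_def power2_eq_square field_simps)
    finally have "(inner k v)\<^sup>2 / inner k k \<le> 0" by simp
    then show ?thesis
      using False by (simp add: divide_le_0_iff not_le flip: inner_gt_zero_iff)
  qed simp
  have "v \<noteq> 0" using \<phi>v zero by auto
  show ?thesis
  proof (intro exI allI)
    fix h
    \<comment> \<open>Since \<open>\<phi> v = 1\<close>, subtracting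
      \<open>\<phi> h *\<^sub>R v\<close> from \<open>h\<close> lands in the kernel; orthogonality
      then gives \<open>inner h v = \<phi> h * inner v v\<close>.\<close>
    have "inner (h - \<phi> h *\<^sub>R v) v = 0"
      using \<phi>v by (intro orth) (simp add: diff scaleR)
    then show "\<phi> h = inner h (v /\<^sub>R inner v v)"
      using \<open>v \<noteq> 0\<close> by (simp add: inner_simps field_simps)
  qed
qed

section \<open>Gradients, subgradients and first-order conditions\<close>

text \<open>The Riesz representation turns the Frechet derivative into an inner product, so the
  definite description behind \<open>gradient\<close> denotes.\<close>

lemma GDERIV_gradient:
  fixes f :: "'h::{real_inner, banach} \<Rightarrow> real"
  assumes "f differentiable (at b)"
  shows "GDERIV f b :> gradient f b"
proof -
  obtain f' where f': "(f has_derivative f') (at b)"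
    using assms by (auto simp: differentiable_def)
  then obtain D where "\<And>h. f' h = inner h D"
    using riesz_representation has_derivative_bounded_linear by metis
  then have "GDERIV f b :> D"
    using f' ext[of f' "\<lambda>h. inner h D"] by (simp add: gderiv_def)
  then show ?thesis
    using gradient_eqI by metis
qed

lemma GDERIV_directional:
  assumes "GDERIV f b :> D"
  shows "DERIV (\<lambda>t. f (b + t *\<^sub>R v)) 0 :> inner v D"
proof -
  have "((\<lambda>t::real. b + t *\<^sub>R v) has_derivative (\<lambda>t. t *\<^sub>R v)) (at 0)"
    by (auto intro!: derivative_eq_intros)
  moreover have "(f has_derivative (\<lambda>h. inner h D)) (at (b + 0 *\<^sub>R v))"
    using assms by (simp add: gderiv_def)
  ultimately have "((\<lambda>t. f (b + t *\<^sub>R v)) has_derivative (\<lambda>t. inner (t *\<^sub>R v) D)) (at 0)"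
    by (rule has_derivative_compose)
  then show ?thesis
    by (simp add: has_field_derivative_def mult.commute[of _ "inner v D"])
qed

text \<open>If \<open>c\<close> exceeded the directional derivative,
  \<open>f (b + t *\<^sub>R v) - t * c\<close> would fall below \<open>f b\<close> for small
  \<open>t\<close>. This one tool yields the gradient inequality, the uniqueness of the subgradient
  and the optimality condition over the aggregates.\<close>

lemma GDERIV_ge_linear_lower_bound:
  assumes f: "GDERIV f b :> D"
    and bound: "\<And>t. 0 < t \<Longrightarrow> t \<le> 1 \<Longrightarrow> f b + t * c \<le> f (b + t *\<^sub>R v)"
  shows "c \<le> inner v D"
proof (rule ccontr)
  assume "\<not> c \<le> inner v D"
  moreover have "DERIV (\<lambda>t. f (b + t *\<^sub>R v) - t * c) 0 :> inner v D - c"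
    by (auto intro!: derivative_eq_intros GDERIV_directional f)
  ultimately obtain d where "0 < d"
    and d: "\<And>t. 0 < t \<Longrightarrow> t < d \<Longrightarrow> f (b + t *\<^sub>R v) - t * c < f b"
    using DERIV_neg_dec_right[of "\<lambda>t. f (b + t *\<^sub>R v) - t * c" "inner v D - c" 0] by auto
  \<comment> \<open>Small enough both for the range allowed in \<open>bound\<close> and for strict
    decrease below \<open>d\<close>.\<close>
  define t where "t = min 1 (d / 2)"
  have "0 < t" "t \<le> 1" "t < d"
    using \<open>0 < d\<close> by (auto simp: t_def)
  then show False
    using d[of t] bound[of t] by auto
qed

lemma convex_on_gradient_inequality:
  assumes f: "convex_on UNIV f" "GDERIV f b :> D"
  shows "f b + inner (b' - b) D \<le> f b'"
proof -
  \<comment> \<open>Convexity bounds \<open>f\<close> from above along the segment, so the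
    lower-bound criterion is applied to \<open>- f\<close>.\<close>
  have "- (f b' - f b) \<le> inner (b' - b) (- D)"
  proof (rule GDERIV_ge_linear_lower_bound[where f = "\<lambda>x. - f x" and b = b])
    show "GDERIV (\<lambda>x. - f x) b :> - D" using f(2) by (rule GDERIV_minus)
    fix t :: real assume "0 < t" "t \<le> 1"
    then have "f ((1 - t) *\<^sub>R b + t *\<^sub>R b') \<le> (1 - t) * f b + t * f b'"
      by (intro convex_onD[OF f(1)]) auto
    moreover have "(1 - t) *\<^sub>R b + t *\<^sub>R b' = b + t *\<^sub>R (b' - b)"
      by (simp add: algebra_simps)
    ultimately show "- f b + t * - (f b' - f b) \<le> - f (b + t *\<^sub>R (b' - b))"
      by (simp add: algebra_simps)
  qed
  then show ?thesis by simp
qed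

text \<open>Testing the subgradient inequality in the direction \<open>l - D\<close> forces the
  squared norm of \<open>l - D\<close> to be at most zero.\<close>

lemma subgradient_eq_gradient:
  assumes D: "GDERIV f b :> D" and l: "\<And>b'. f b + inner (b' - b) l \<le> f b'"
  shows "l = D"
proof -
  have "inner (l - D) l \<le> inner (l - D) D"
  proof (rule GDERIV_ge_linear_lower_bound[OF D])
    fix t :: real
    show "f b + t * inner (l - D) l \<le> f (b + t *\<^sub>R (l - D))"
      using l[of "b + t *\<^sub>R (l - D)"] by simp
  qed
  then have "inner (l - D) (l - D) \<le> 0" by (simp add: inner_diff_right)
  then show ?thesis
    using inner_gt_zero_iff[of "l - D"] by (simp add: not_le del: inner_gt_zero_iff)
qed

section \<open>Measurable selections\<close>

text \<open>
  The selection is the limit of centres of balls of radius \<open>1 / 2 ^ k\<close>, each chosen as the first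
  ball of a dense sequence of centres that meets what the earlier balls have left of \<open>B x\<close>.
\<close>

lemma measurable_selection:
  fixes B :: "'a \<Rightarrow> 'y::polish_space set"
  assumes closed: "\<And>x. x \<in> space M \<Longrightarrow> closed (B x)"
    and ne: "\<And>x. x \<in> space M \<Longrightarrow> B x \<noteq> {}"
    and meas: "\<And>C. closed C \<Longrightarrow> {x \<in> space M. B x \<inter> C \<noteq> {}} \<in> sets M"
  shows "\<exists>s \<in> borel_measurable M. \<forall>x \<in> space M. s x \<in> B x"
proof -
  obtain E :: "'y set" where "countable E" and E: "\<And>U. open U \<Longrightarrow> U \<noteq> {} \<Longrightarrow> \<exists>e\<in>E. e \<in> U"
    using countable_dense_setE by metis
  define y where "y = from_nat_into E"
  have "E \<noteq> {}" using E[OF open_UNIV] by auto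
  then have y: "\<exists>n. y n \<in> U" if "open U" "U \<noteq> {}" for U
    using E[OF that] \<open>countable E\<close> unfolding y_def by (metis from_nat_into_surj)
  define r :: "nat \<Rightarrow> real" where "r k = (1/2) ^ k" for k
  define idx where "idx k S = (LEAST n. S \<inter> cball (y n) (r k) \<noteq> {})" for k S
  define T where "T x = rec_nat (B x) (\<lambda>k S. S \<inter> cball (y (idx k S)) (r k))" for x
  have T_0: "T x 0 = B x" and T_Suc: "T x (Suc k) = T x k \<inter> cball (y (idx k (T x k))) (r k)" for x k
    by (auto simp: T_def)
  have T_ne: "T x k \<noteq> {}" if "x \<in> space M" for x k
  proof (induction k)
    case (Suc k)
    then obtain b where b: "b \<in> T x k" by auto
    obtain n where "y n \<in> ball b (r k)"
      using y[of "ball b (r k)"] by (auto simp: r_def not_le)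
    then have "T x k \<inter> cball (y n) (r k) \<noteq> {}"
      using b by (force simp: dist_commute)
    then show ?case
      unfolding T_Suc idx_def by (rule LeastI)
  qed (use ne that T_0 in auto)
  have T_closed: "closed (T x k)" if "x \<in> space M" for x k
    by (induction k) (use closed that in \<open>auto simp: T_0 T_Suc\<close>)
  have T_dec: "T x k \<subseteq> T x j" if "j \<le> k" for x j k
    using lift_Suc_antimono_le[of "T x", OF _ that] T_Suc by auto
  have idx_measurable: "(\<lambda>x. idx k (T x k)) \<in> measurable M (count_space UNIV)"
    if "\<And>C. closed C \<Longrightarrow> Measurable.pred M (\<lambda>x. T x k \<inter> C \<noteq> {})" for k
    unfolding idx_def by (intro measurable_Least that) simp
  \<comment> \<open>The induction needs all closed \<open>C\<close> at once:
    \<open>T x (Suc k)\<close> meets \<open>C\<close> iff \<open>T x k\<close> meets the closed set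
    \<open>cball (y n) (r k) \<inter> C\<close> with \<open>n\<close> the chosen index. That index
    is itself measurable by the induction hypothesis and takes countably many values.\<close>
  have T_measurable: "Measurable.pred M (\<lambda>x. T x k \<inter> C \<noteq> {})" if "closed C" for k C
    using that
  proof (induction k arbitrary: C)
    case 0
    then show ?case using meas by (simp add: T_0 pred_def)
  next
    case (Suc k)
    have "Measurable.pred M (\<lambda>x. T x k \<inter> (cball (y n) (r k) \<inter> C) \<noteq> {})" for n
      using Suc by (intro Suc.IH) auto
    from measurable_compose_countable[OF this idx_measurable[OF Suc.IH]]
    show ?case by (simp add: T_Suc Int_assoc)
  qed
  define c where "c k x = y (idx k (T x k))" for k x
  have c_measurable: "c k \<in> borel_measurable M" for k
    unfolding c_def by (rule measurable_compose[OF idx_measurable[OF T_measurable]]) auto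
  have T_c: "dist (c k x) z \<le> r k" if "z \<in> T x (Suc k)" for k x z
    using that by (simp add: T_Suc c_def)
  have r_lim: "r \<longlonglongrightarrow> 0"
    unfolding r_def by (rule LIMSEQ_power_zero) simp
  have "\<exists>z. z \<in> B x \<and> (\<lambda>k. c k x) \<longlonglongrightarrow> z" if "x \<in> space M" for x
  proof -
    \<comment> \<open>Cantor intersection: any two points of \<open>T x (Suc k)\<close> are within
      \<open>2 * r k\<close> of each other. The single common point is the limit of the centres
      \<open>c k x\<close>.\<close>
    have "\<exists>a. \<Inter>(range (T x)) = {a}"
    proof (rule decreasing_closed_nest_sing[OF T_closed[OF that] T_ne[OF that] T_dec])
      fix e :: real assume "0 < e"
      then obtain k where "r k < e / 2"
        using order_tendstoD(2)[OF r_lim, of "e/2"] by (auto simp: eventually_sequentially)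
      then have "dist p q < e" if "p \<in> T x (Suc k)" "q \<in> T x (Suc k)" for p q
        using T_c[OF that(1)] T_c[OF that(2)] dist_triangle3[of p q "c k x"] by linarith
      then show "\<exists>n. \<forall>p\<in>T x n. \<forall>q\<in>T x n. dist p q < e" by blast
    qed
    then obtain z where z: "\<And>k. z \<in> T x k" by blast
    have "(\<lambda>k. c k x) \<longlonglongrightarrow> z"
      by (rule metric_tendsto_imp_tendsto[OF r_lim])
        (use T_c z in \<open>auto intro!: always_eventually simp: r_def\<close>)
    then show ?thesis using z[of 0] T_0 by auto
  qed
  then obtain s where s: "\<And>x. x \<in> space M \<Longrightarrow> s x \<in> B x \<and> (\<lambda>k. c k x) \<longlonglongrightarrow> s x"
    by metis
  then have "s \<in> borel_measurable M"
    by (intro borel_measurable_LIMSEQ_metric[where f = c, OF c_measurable]) blast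
  with s show ?thesis by blast
qed

text \<open>Upper semi-continuity, applied to open neighbourhoods of \<open>F x\<close> of radius
  \<open>e\<close>, drives the distance from \<open>t n\<close> to \<open>F x\<close> to zero.
  Nearest points \<open>w n\<close> in the compact set \<open>F x\<close> have a convergent
  subsequence, and \<open>t\<close> follows it.\<close>

lemma usc_compact_selection_convergent_subsequence:
  fixes F :: "'a::metric_space \<Rightarrow> 'b::metric_space set"
  assumes F: "usc_map_on X F" "compact (F x)" "F x \<noteq> {}" and x: "x \<in> X"
    and s: "\<And>n. s n \<in> X" "s \<longlonglongrightarrow> x" and t: "\<And>n. t n \<in> F (s n)"
  shows "\<exists>y\<in>F x. \<exists>r. strict_mono r \<and> (t \<circ> r) \<longlonglongrightarrow> y"
proof -
  have lim: "(\<lambda>n. infdist (t n) (F x)) \<longlonglongrightarrow> 0"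
  proof (rule order_tendstoI)
    fix e :: real assume "0 < e"
    define U where "U = {z. infdist z (F x) < e}"
    have "open U"
      unfolding U_def by (intro open_Collect_less continuous_intros)
    then have "F x \<subseteq> interior U"
      using \<open>0 < e\<close> by (auto simp: interior_open U_def)
    then obtain \<eta> where \<eta>: "0 < \<eta>" "\<And>x'. x' \<in> X \<Longrightarrow> dist x x' \<le> \<eta> \<Longrightarrow> F x' \<subseteq> U"
      using F(1) x unfolding usc_map_on_def by meson
    have "\<forall>\<^sub>F n in sequentially. dist (s n) x < \<eta>"
      using s(2) \<eta>(1) by (rule tendstoD)
    then show "\<forall>\<^sub>F n in sequentially. infdist (t n) (F x) < e"
    proof eventually_elim
      fix n assume "dist (s n) x < \<eta>"
      then have "F (s n) \<subseteq> U"
        by (intro \<eta>(2) s(1)) (simp add: dist_commute)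
      then show "infdist (t n) (F x) < e"
        using t[of n] by (auto simp: U_def)
    qed
  qed (auto intro!: always_eventually elim: less_le_trans simp: infdist_nonneg)
  have "\<exists>w\<in>F x. dist (t n) w \<le> infdist (t n) (F x)" for n
  proof -
    have "continuous_on (F x) (dist (t n))"
      by (intro continuous_intros)
    then obtain w where "w \<in> F x" "\<And>z. z \<in> F x \<Longrightarrow> dist (t n) w \<le> dist (t n) z"
      using continuous_attains_inf[OF F(2,3)] by metis
    then show ?thesis
      using F(3) by (auto simp: infdist_notempty intro!: cINF_greatest)
  qed
  then obtain w where w: "\<And>n. w n \<in> F x" "\<And>n. dist (t n) (w n) \<le> infdist (t n) (F x)"
    by metis
  obtain y r where y: "y \<in> F x" and r: "strict_mono r" "(w \<circ> r) \<longlonglongrightarrow> y"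
    using F(2) w(1) unfolding compact_def by metis
  have "(\<lambda>n. dist (t (r n)) (w (r n))) \<longlonglongrightarrow> 0"
    using w(2) by (intro Lim_null_comparison[OF _ LIMSEQ_subseq_LIMSEQ[OF lim r(1)]])
      (auto intro!: always_eventually)
  moreover have "(\<lambda>n. dist (w (r n)) y) \<longlonglongrightarrow> 0"
    using iffD1[OF tendsto_dist_iff r(2)] by (simp add: o_def)
  ultimately have "(\<lambda>n. dist (t (r n)) (w (r n)) + dist (w (r n)) y) \<longlonglongrightarrow> 0"
    by (rule tendsto_add_zero)
  then have "(\<lambda>n. t (r n)) \<longlonglongrightarrow> y"
    by (rule metric_tendsto_imp_tendsto) (auto intro!: always_eventually dist_triangle)
  then show ?thesis
    using y r(1) by (auto simp: o_def)
qed

section \<open>Measures with a prescribed marginal\<close>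

lemma probs_with_marginalD:
  assumes "\<mu> \<in> probs_with_marginal X F m"
  shows "prob_space \<mu>" and "sets \<mu> = sets (restrict_space borel (Sigma X F))"
    and "space \<mu> = Sigma X F" and "distr \<mu> (restrict_space borel X) fst = m"
proof -
  show "prob_space \<mu>" and sets: "sets \<mu> = sets (restrict_space borel (Sigma X F))"
    and "distr \<mu> (restrict_space borel X) fst = m"
    using assms by (auto simp: probs_with_marginal_def borel_probs_def space_prob_algebra)
  show "space \<mu> = Sigma X F"
    using sets_eq_imp_space_eq[OF sets] by (simp add: space_restrict_space)
qed

lemma measurable_fst_restrict_Sigma:
  "fst \<in> restrict_space borel (Sigma X F) \<rightarrow>\<^sub>M restrict_space (borel :: 'a::topological_space measure) X"
    (is "_ \<in> measurable (restrict_space (borel :: ('a \<times> 'b::topological_space) measure) _) _")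
  by (intro measurable_restrict_space3 borel_measurable_continuous_onI continuous_intros) auto

lemma bounded_integrable_probs:
  fixes h :: "'z::topological_space \<Rightarrow> 'b::{banach, second_countable_topology}"
  assumes "prob_space \<mu>" "sets \<mu> = sets (restrict_space borel S)"
    and "h \<in> borel_measurable (restrict_space borel S)" "bounded (h ` S)"
  shows "integrable \<mu> h"
proof -
  have "space \<mu> = S"
    using sets_eq_imp_space_eq[OF assms(2)] by (simp add: space_restrict_space)
  moreover obtain B where "\<And>z. z \<in> S \<Longrightarrow> norm (h z) \<le> B"
    using assms(4) by (auto simp: bounded_iff)
  ultimately show ?thesis
    using assms(2,3)
    by (intro finite_measure.integrable_const_bound[OF prob_space.finite_measure[OF assms(1)], of _ B])
      (auto cong: measurable_cong_sets)
qed

lemma bounded_image_inner: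
  assumes "bounded (h ` S)"
  shows "bounded ((\<lambda>z. inner l (h z)) ` S)"
  using bounded_linear_image[OF assms bounded_linear_inner_right[of l]] by (simp add: image_image)

text \<open>\<open>\<rho>\<close> is the convex combination of \<open>\<mu>\<close> and
  \<open>\<nu>\<close> with weights \<open>t\<close> and \<open>1 - t\<close>, encoded as drawing
  one of them by a biased coin. In this form the marginal and the integrals follow from the laws of
  the probability monad.\<close>

lemma mixture_probs_with_marginal:
  assumes m: "m \<in> borel_probs X"
    and \<mu>: "\<mu> \<in> probs_with_marginal X F m" and \<nu>: "\<nu> \<in> probs_with_marginal X F m"
    and t: "0 \<le> t" "t \<le> 1"
  defines "\<rho> \<equiv> measure_pmf (bernoulli_pmf t) \<bind> (\<lambda>b. if b then \<mu> else \<nu>)"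
  shows "\<rho> \<in> probs_with_marginal X F m"
    and "\<And>h::_ \<Rightarrow> real. h \<in> borel_measurable (restrict_space borel (Sigma X F)) \<Longrightarrow>
        bounded (h ` Sigma X F) \<Longrightarrow>
        (\<integral>z. h z \<partial>\<rho>) = t * (\<integral>z. h z \<partial>\<mu>) + (1 - t) * (\<integral>z. h z \<partial>\<nu>)"
proof -
  define N where "N b = (if b then \<mu> else \<nu>)" for b
  let ?S = "restrict_space borel (Sigma X F)" and ?B = "measure_pmf (bernoulli_pmf t)"
  have \<rho>: "\<rho> = ?B \<bind> N" by (simp add: \<rho>_def N_def[abs_def])
  have N_mem: "N b \<in> probs_with_marginal X F m" for b
    using \<mu> \<nu> by (simp add: N_def)
  note N_facts = probs_with_marginalD[OF N_mem]
  have "N \<in> count_space UNIV \<rightarrow>\<^sub>M prob_algebra ?S"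
    using N_facts by (auto simp: space_prob_algebra)
  then have N: "N \<in> ?B \<rightarrow>\<^sub>M prob_algebra ?S"
    by (simp cong: measurable_cong_sets)
  have B: "?B \<in> space (prob_algebra ?B)"
    by (simp add: space_prob_algebra measure_pmf.prob_space_axioms)
  have "\<rho> \<in> space (prob_algebra ?S)"
    using measurable_space[OF measurable_bind_prob_space[OF measurable_ident N] B] by (simp add: \<rho>)
  moreover have "distr \<rho> (restrict_space borel X) fst = m"
  proof -
    \<comment> \<open>Projection commutes with the mixture, and both components project to
      \<open>m\<close>, so a constant kernel remains.\<close>
    have "distr \<rho> (restrict_space borel X) fst = ?B \<bind> (\<lambda>b. distr (N b) (restrict_space borel X) fst)"
      unfolding \<rho> by (rule distr_bind[OF measurable_prob_algebraD[OF N] _ measurable_fst_restrict_Sigma]) simp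
    also have "\<dots> = m"
      using m by (simp add: N_facts bind_const' measure_pmf.prob_space_axioms borel_probs_def
          space_prob_algebra prob_space_imp_subprob_space)
    finally show ?thesis .
  qed
  ultimately show "\<rho> \<in> probs_with_marginal X F m"
    by (simp add: probs_with_marginal_def borel_probs_def)
  fix h :: "_ \<Rightarrow> real"
  assume h: "h \<in> borel_measurable ?S" "bounded (h ` Sigma X F)"
  obtain C where C: "\<And>z. z \<in> Sigma X F \<Longrightarrow> \<bar>h z\<bar> \<le> C"
    using h(2) by (auto simp: bounded_iff)
  have "(\<integral>z. h z \<partial>\<rho>) = (\<integral>b. \<integral>z. h z \<partial>N b \<partial>?B)"
    unfolding \<rho>
  proof (rule integral_bind[where K = ?S and B = C and B' = 1])
    show "h \<in> borel_measurable ?S" by (rule h(1))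
    show "N \<in> ?B \<rightarrow>\<^sub>M subprob_algebra ?S" by (rule measurable_prob_algebraD[OF N])
    show "finite_measure ?B" by (rule measure_pmf.finite_measure_axioms)
    show "AE b in ?B. emeasure (N b) (space (N b)) \<le> ennreal 1"
      by (simp add: prob_space.emeasure_space_1[OF N_facts(1)])
    show "\<bar>h z\<bar> \<le> C" if "z \<in> space ?S" for z
      using that by (intro C) (simp add: space_restrict_space)
  qed
  then show "(\<integral>z. h z \<partial>\<rho>) = t * (\<integral>z. h z \<partial>\<mu>) + (1 - t) * (\<integral>z. h z \<partial>\<nu>)"
    using t by (simp add: N_def)
qed

lemma convex_aggregates:
  fixes g :: "_ \<Rightarrow> 'h::{real_inner, banach, second_countable_topology}"
  assumes m: "m \<in> borel_probs X"
    and g: "g \<in> borel_measurable (restrict_space borel (Sigma X F))" "bounded (g ` Sigma X F)"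
  shows "convex (aggregates X F g m)"
proof (rule convexI)
  fix a b and u v :: real
  assume "a \<in> aggregates X F g m" "b \<in> aggregates X F g m" and uv: "0 \<le> u" "0 \<le> v" "u + v = 1"
  then obtain \<mu> \<nu> where \<mu>: "\<mu> \<in> probs_with_marginal X F m" "a = (\<integral>z. g z \<partial>\<mu>)"
    and \<nu>: "\<nu> \<in> probs_with_marginal X F m" "b = (\<integral>z. g z \<partial>\<nu>)"
    by (auto simp: aggregates_def)
  have u: "u \<le> 1" and v: "v = 1 - u" using uv by auto
  note mix = mixture_probs_with_marginal[OF m \<mu>(1) \<nu>(1) uv(1) u]
  define \<rho> where "\<rho> = measure_pmf (bernoulli_pmf u) \<bind> (\<lambda>b. if b then \<mu> else \<nu>)"
  have \<rho>: "\<rho> \<in> probs_with_marginal X F m" using mix(1) by (simp add: \<rho>_def)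
  have int: "integrable \<kappa> g" if "\<kappa> \<in> probs_with_marginal X F m" for \<kappa>
    using probs_with_marginalD[OF that] g by (intro bounded_integrable_probs)
  \<comment> \<open>Vectors are compared by testing against every \<open>w\<close>, which reduces
    the vector-valued integrals to the real ones covered by the mixture formula.\<close>
  have "inner w (\<integral>z. g z \<partial>\<rho>) = inner w (u *\<^sub>R a + v *\<^sub>R b)" for w
  proof -
    have "(\<integral>z. inner w (g z) \<partial>\<rho>) = u * (\<integral>z. inner w (g z) \<partial>\<mu>) + (1 - u) * (\<integral>z. inner w (g z) \<partial>\<nu>)"
      unfolding \<rho>_def
      by (intro mix(2) bounded_image_inner g borel_measurable_inner borel_measurable_const)
    then show ?thesis
      using \<mu> \<nu> \<rho> int by (simp add: v inner_simps)
  qed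
  then have "u *\<^sub>R a + v *\<^sub>R b = (\<integral>z. g z \<partial>\<rho>)"
    by (metis vector_eq_rdot inner_commute)
  then show "u *\<^sub>R a + v *\<^sub>R b \<in> aggregates X F g m"
    using \<rho> by (auto simp: aggregates_def)
qed

lemma bounded_aggregates:
  fixes g :: "_ \<Rightarrow> 'h::{real_inner, banach, second_countable_topology}"
  assumes "g \<in> borel_measurable (restrict_space borel (Sigma X F))" "bounded (g ` Sigma X F)"
  shows "bounded (aggregates X F g m)"
proof -
  obtain C where C: "\<And>z. z \<in> Sigma X F \<Longrightarrow> norm (g z) \<le> C"
    using assms(2) by (auto simp: bounded_iff)
  have "norm (\<integral>z. g z \<partial>\<mu>) \<le> C" if "\<mu> \<in> probs_with_marginal X F m" for \<mu>
  proof -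
    note \<mu> = probs_with_marginalD[OF that]
    have "integrable \<mu> g"
      by (rule bounded_integrable_probs[OF \<mu>(1,2) assms])
    then have "(\<integral>z. norm (g z) \<partial>\<mu>) \<le> (\<integral>z. C \<partial>\<mu>)"
      using C by (intro integral_mono finite_measure.integrable_const integrable_norm
          prob_space.finite_measure \<mu>(1)) (use \<mu>(3) in auto)
    also have "\<dots> = C"
      by (simp add: prob_space.prob_space[OF \<mu>(1)])
    finally show ?thesis
      using integral_norm_bound[of \<mu> g] by linarith
  qed
  then show ?thesis
    by (auto simp: bounded_iff aggregates_def)
qed

section \<open>Best responses\<close>

lemma bounded_bdd_below_scalarized:
  assumes "bounded (g ` Sigma X F)" "x \<in> X"
  shows "bdd_below ((\<lambda>y. scalarized g l (x, y)) ` F x)"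
proof -
  have "(\<lambda>y. scalarized g l (x, y)) ` F x \<subseteq> (\<lambda>z. inner l (g z)) ` Sigma X F"
    using assms(2) by (auto simp: scalarized_def)
  then show ?thesis
    by (rule bdd_below_mono[OF bounded_imp_bdd_below[OF bounded_image_inner[OF assms(1)]]])
qed

lemma lower_value_le:
  assumes "bounded (g ` Sigma X F)" "x \<in> X" "y \<in> F x"
  shows "lower_value F g l x \<le> inner l (g (x, y))"
  using cINF_lower[OF bounded_bdd_below_scalarized[OF assms(1,2)] assms(3), of l]
  by (simp add: lower_value_def scalarized_def)

lemma lower_value_attained:
  assumes "continuous_on (Sigma X F) g" "compact (F x)" "F x \<noteq> {}" "x \<in> X"
  shows "\<exists>y\<in>F x. inner l (g (x, y)) = lower_value F g l x"
proof -
  have "continuous_on (F x) (\<lambda>y. inner l (g (x, y)))"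
    using assms by (intro continuous_intros continuous_on_compose2[OF assms(1)]) auto
  then obtain y where y: "y \<in> F x" "\<And>z. z \<in> F x \<Longrightarrow> inner l (g (x, y)) \<le> inner l (g (x, z))"
    using continuous_attains_inf[OF assms(2,3)] by metis
  then have "(INF z\<in>F x. inner l (g (x, z))) = inner l (g (x, y))"
    by (intro cInf_eq_minimum) auto
  then show ?thesis
    using y by (auto simp: lower_value_def scalarized_def)
qed

text \<open>Every \<open>g (x1, y)\<close> lies within \<open>C * dist x1 x2\<close> of some
  \<open>g (x2, y')\<close>, so by Cauchy-Schwarz the inner product with \<open>l\<close> differs by
  at most \<open>norm l\<close> times that. Exchanging \<open>x1\<close> and \<open>x2\<close> gives
  Lipschitz continuity.\<close>

lemma lower_value_diff_le:
  assumes F: "\<And>x. x \<in> X \<Longrightarrow> F x \<noteq> {}" and g: "bounded (g ` Sigma X F)"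
    and Z: "lipschitz_map_on C X (\<lambda>x. {g (x, y) | y. y \<in> F x})"
    and x: "x1 \<in> X" "x2 \<in> X"
  shows "lower_value F g l x2 - norm l * C * dist x1 x2 \<le> lower_value F g l x1"
proof -
  have "lower_value F g l x2 - norm l * C * dist x1 x2 \<le> inner l (g (x1, y))" if "y \<in> F x1" for y
  proof -
    have "g (x1, y) \<in> {v + w |v w. v \<in> {g (x2, y) |y. y \<in> F x2} \<and> w \<in> cball 0 (C * dist x1 x2)}"
      using Z x that unfolding lipschitz_map_on_def by blast
    then obtain y' w where y': "y' \<in> F x2" and w: "norm w \<le> C * dist x1 x2"
      and eq: "g (x1, y) = g (x2, y') + w"
      by auto
    have "\<bar>inner l w\<bar> \<le> norm l * (C * dist x1 x2)"
      using Cauchy_Schwarz_ineq2[of l w] mult_left_mono[OF w, of "norm l"] by simp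
    then show ?thesis
      using lower_value_le[OF g x(2) y', of l] by (simp add: eq inner_simps mult.assoc)
  qed
  then show ?thesis
    unfolding lower_value_def[of F g l x1] scalarized_def using F x by (intro cINF_greatest) auto
qed

lemma lower_value_continuous:
  assumes "\<And>x. x \<in> X \<Longrightarrow> F x \<noteq> {}" "bounded (g ` Sigma X F)" "0 \<le> C"
    and "lipschitz_map_on C X (\<lambda>x. {g (x, y) | y. y \<in> F x})"
  shows "continuous_on X (lower_value F g l)"
proof -
  have "(norm l * C)-lipschitz_on X (lower_value F g l)"
  proof (rule lipschitz_onI)
    fix x y assume "x \<in> X" "y \<in> X"
    then show "dist (lower_value F g l x) (lower_value F g l y) \<le> norm l * C * dist x y"
      using lower_value_diff_le[OF assms(1,2,4), of x y l] lower_value_diff_le[OF assms(1,2,4), of y x l]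
      by (simp add: dist_real_def abs_le_iff dist_commute)
  qed (use assms(3) in simp)
  then show ?thesis
    by (rule lipschitz_on_continuous_on)
qed

lemma bounded_lower_value:
  assumes "\<And>x. x \<in> X \<Longrightarrow> F x \<noteq> {}" "bounded (g ` Sigma X F)"
  shows "bounded (lower_value F g l ` X)"
proof -
  obtain C where C: "\<And>z. z \<in> Sigma X F \<Longrightarrow> \<bar>inner l (g z)\<bar> \<le> C"
    using bounded_image_inner[OF assms(2), of l] by (auto simp: bounded_iff)
  have "\<bar>lower_value F g l x\<bar> \<le> C" if x: "x \<in> X" for x
  proof -
    obtain y where y: "y \<in> F x" using assms(1)[OF x] by auto
    have "- C \<le> lower_value F g l x"
      unfolding lower_value_def scalarized_def using assms(1)[OF x] C x
      by (intro cINF_greatest) (auto simp: abs_le_iff minus_le_iff)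
    moreover have "lower_value F g l x \<le> C"
      using lower_value_le[OF assms(2) x y, of l] C[of "(x, y)"] x y by auto
    ultimately show ?thesis by (simp add: abs_le_iff)
  qed
  then show ?thesis by (auto simp: bounded_iff)
qed

section \<open>Minimizing the inner product with \<open>l\<close> over the aggregates\<close>

lemma inner_integral_probs:
  fixes g :: "_ \<Rightarrow> 'h::{real_inner, banach, second_countable_topology}"
  assumes "\<mu> \<in> probs_with_marginal X F m"
    and "g \<in> borel_measurable (restrict_space borel (Sigma X F))" "bounded (g ` Sigma X F)"
  shows "integrable \<mu> (\<lambda>z. inner l (g z))" "inner l (\<integral>z. g z \<partial>\<mu>) = (\<integral>z. inner l (g z) \<partial>\<mu>)"
  using bounded_integrable_probs[OF probs_with_marginalD(1,2)[OF assms(1)] assms(2,3)]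
  by auto

text \<open>The marginal condition turns the integral over \<open>m\<close> into one over
  \<open>\<mu>\<close>, where the pointwise bound \<open>lower_value_le\<close> can be integrated.
  Continuity of the lower value supplies its measurability.\<close>

lemma integral_lower_value_le:
  fixes g :: "_ \<Rightarrow> 'h::{real_inner, banach, second_countable_topology}"
  assumes F: "\<And>x. x \<in> X \<Longrightarrow> F x \<noteq> {}"
    and g: "g \<in> borel_measurable (restrict_space borel (Sigma X F))" "bounded (g ` Sigma X F)"
    and u: "continuous_on X (lower_value F g l)"
    and \<mu>: "\<mu> \<in> probs_with_marginal X F m"
  shows "(\<integral>x. lower_value F g l x \<partial>m) \<le> inner l (\<integral>z. g z \<partial>\<mu>)"
proof -
  note facts = probs_with_marginalD[OF \<mu>]
  have fst: "fst \<in> \<mu> \<rightarrow>\<^sub>M restrict_space borel X"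
    using measurable_fst_restrict_Sigma[of X F] facts(2) by (simp cong: measurable_cong_sets)
  have u_meas: "lower_value F g l \<in> borel_measurable (restrict_space borel X)"
    using u by (rule borel_measurable_continuous_on_restrict)
  have eq: "(\<integral>x. lower_value F g l x \<partial>m) = (\<integral>z. lower_value F g l (fst z) \<partial>\<mu>)"
    by (subst facts(4)[symmetric]) (rule integral_distr[OF fst u_meas])
  have "bounded ((\<lambda>z. lower_value F g l (fst z)) ` Sigma X F)"
    by (rule bounded_subset[OF bounded_lower_value[OF F g(2)]]) auto
  then have "integrable \<mu> (\<lambda>z. lower_value F g l (fst z))"
    using facts(1,2)
    by (rule bounded_integrable_probs[rotated 3])
      (rule measurable_compose[OF measurable_fst_restrict_Sigma u_meas])
  then have "(\<integral>z. lower_value F g l (fst z) \<partial>\<mu>) \<le> (\<integral>z. inner l (g z) \<partial>\<mu>)"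
    using inner_integral_probs(1)[OF \<mu> g] lower_value_le[OF g(2)] facts(3)
    by (intro integral_mono) auto
  then show ?thesis
    by (simp add: eq inner_integral_probs(2)[OF \<mu> g])
qed

text \<open>
  A measurable selection \<open>s\<close> of the best responses pushes \<open>m\<close> forward along \<open>x \<mapsto> (x, s x)\<close>.
\<close>

lemma exists_best_response_measure:
  fixes X :: "'x::{banach, second_countable_topology} set"
    and F :: "'x \<Rightarrow> 'y::polish_space set"
    and g :: "'x \<times> 'y \<Rightarrow> 'h::{real_inner, banach, second_countable_topology}"
  assumes X: "closed X" and m: "m \<in> borel_probs X"
    and F: "\<And>x. x \<in> X \<Longrightarrow> F x \<noteq> {}" "\<And>x. x \<in> X \<Longrightarrow> compact (F x)" "usc_map_on X F"
    and g: "continuous_on (Sigma X F) g" "bounded (g ` Sigma X F)"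
    and u: "continuous_on X (lower_value F g l)"
  shows "\<exists>\<mu>\<in>probs_with_marginal X F m. inner l (\<integral>z. g z \<partial>\<mu>) = (\<integral>x. lower_value F g l x \<partial>m)"
proof -
  \<comment> \<open>Best responses are described by an equation, because equations between
    continuous expressions pass to limits.\<close>
  define B where "B x = {y \<in> F x. inner l (g (x, y)) = lower_value F g l x}" for x
  have m_prob: "prob_space m" and m_sets: "sets m = sets (restrict_space borel X)"
    using m by (auto simp: borel_probs_def space_prob_algebra)
  have m_space: "space m = X"
    using sets_eq_imp_space_eq[OF m_sets] by (simp add: space_restrict_space)
  \<comment> \<open>Supplies the measurability hypothesis of \<open>measurable_selection\<close>.
    Best responses \<open>t n\<close> at \<open>s n\<close> subconverge to some \<open>y\<close> in
    \<open>F x\<close>, and continuity of \<open>g\<close> and of the lower value carries the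
    defining equation over to \<open>y\<close>.\<close>
  have hit_closed: "closed {x \<in> X. B x \<inter> C \<noteq> {}}" if C: "closed C" for C
    unfolding closed_sequential_limits
  proof (intro allI impI)
    fix s x assume s: "(\<forall>n. s n \<in> {x \<in> X. B x \<inter> C \<noteq> {}}) \<and> s \<longlonglongrightarrow> x"
    then have sX: "\<And>n. s n \<in> X" and lim: "s \<longlonglongrightarrow> x" by auto
    have x: "x \<in> X" using closed_sequentially[OF X] sX lim by blast
    have "\<exists>y. y \<in> B (s n) \<inter> C" for n using s by blast
    then obtain t where t: "\<And>n. t n \<in> B (s n) \<inter> C" by metis
    have "t n \<in> F (s n)" for n using t by (auto simp: B_def)
    from usc_compact_selection_convergent_subsequence[OF F(3) F(2)[OF x] F(1)[OF x] x sX lim this]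
    obtain y r where y: "y \<in> F x" and r: "strict_mono r" "(t \<circ> r) \<longlonglongrightarrow> y" by blast
    have "y \<in> C"
      using closed_sequentially[OF C _ r(2)] t by auto
    have sr: "(\<lambda>n. s (r n)) \<longlonglongrightarrow> x"
      using LIMSEQ_subseq_LIMSEQ[OF lim r(1)] by (simp add: o_def)
    have "(\<lambda>n. g (s (r n), t (r n))) \<longlonglongrightarrow> g (x, y)"
      by (rule continuous_on_tendsto_compose[OF g(1)])
        (use sr r(2) x y sX t in \<open>auto intro!: tendsto_Pair simp: o_def B_def\<close>)
    then have "(\<lambda>n. inner l (g (s (r n), t (r n)))) \<longlonglongrightarrow> inner l (g (x, y))"
      by (intro tendsto_intros)
    moreover have "(\<lambda>n. lower_value F g l (s (r n))) \<longlonglongrightarrow> lower_value F g l x"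
      by (rule continuous_on_tendsto_compose[OF u sr x]) (use sX in auto)
    moreover have "inner l (g (s (r n), t (r n))) = lower_value F g l (s (r n))" for n
      using t[of "r n"] by (auto simp: B_def)
    ultimately have "inner l (g (x, y)) = lower_value F g l x"
      using LIMSEQ_unique by simp
    then show "x \<in> {x \<in> X. B x \<inter> C \<noteq> {}}"
      using x y \<open>y \<in> C\<close> by (auto simp: B_def)
  qed
  have "\<exists>s\<in>borel_measurable m. \<forall>x\<in>space m. s x \<in> B x"
  proof (rule measurable_selection)
    fix x assume "x \<in> space m"
    then have x: "x \<in> X" by (simp add: m_space)
    show "closed (B x)"
      unfolding B_def
      by (intro continuous_closed_preimage_constant compact_imp_closed F(2) x continuous_intros
          continuous_on_compose2[OF g(1)]) (use x in auto)
    show "B x \<noteq> {}"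
      using lower_value_attained[OF g(1) F(2) F(1)] x by (auto simp: B_def)
  next
    fix C :: "'y set" assume "closed C"
    then have "{x \<in> X. B x \<inter> C \<noteq> {}} \<in> sets borel"
      by (intro borel_closed hit_closed)
    then show "{x \<in> space m. B x \<inter> C \<noteq> {}} \<in> sets m"
      unfolding m_space m_sets sets_restrict_space by (rule rev_image_eqI) auto
  qed
  then obtain s where s: "s \<in> borel_measurable m" "\<And>x. x \<in> X \<Longrightarrow> s x \<in> B x"
    by (auto simp: m_space)
  let ?S = "restrict_space borel (Sigma X F)"
  have id: "(\<lambda>x. x) \<in> borel_measurable m"
    by (simp add: measurable_cong_sets[OF m_sets refl] measurable_restrict_space1)
  have pair: "(\<lambda>x. (x, s x)) \<in> m \<rightarrow>\<^sub>M ?S"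
    by (rule measurable_restrict_space2)
      (use s id in \<open>auto simp: m_space B_def intro: borel_measurable_Pair\<close>)
  define \<mu> where "\<mu> = distr m ?S (\<lambda>x. (x, s x))"
  have "distr \<mu> (restrict_space borel X) fst = distr m (restrict_space borel X) (fst \<circ> (\<lambda>x. (x, s x)))"
    unfolding \<mu>_def by (rule distr_distr[OF measurable_fst_restrict_Sigma pair])
  also have "\<dots> = m"
    by (simp add: o_def distr_id2 m_sets)
  finally have \<mu>: "\<mu> \<in> probs_with_marginal X F m"
    using prob_space.prob_space_distr[OF m_prob pair]
    by (simp add: probs_with_marginal_def borel_probs_def space_prob_algebra \<mu>_def)
  have g_meas: "g \<in> borel_measurable ?S"
    using g(1) by (rule borel_measurable_continuous_on_restrict)
  have "inner l (\<integral>z. g z \<partial>\<mu>) = (\<integral>z. inner l (g z) \<partial>\<mu>)"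
    by (rule inner_integral_probs(2)[OF \<mu> g_meas g(2)])
  also have "\<dots> = (\<integral>x. inner l (g (x, s x)) \<partial>m)"
    unfolding \<mu>_def by (intro integral_distr pair borel_measurable_inner borel_measurable_const g_meas)
  also have "\<dots> = (\<integral>x. lower_value F g l x \<partial>m)"
    using s(2) by (intro Bochner_Integration.integral_cong) (auto simp: m_space B_def)
  finally show ?thesis using \<mu> by blast
qed

section \<open>Duality\<close>

lemma fenchel_young: "ereal (inner l b - f b) \<le> fenchel_conjugate f l"
  unfolding fenchel_conjugate_def by (rule SUP_upper) simp

text \<open>The gradient inequality says that \<open>b\<close> maximizes
  \<open>inner D b' - f b'\<close> over all \<open>b'\<close>. In particular the conjugate is finite
  at every gradient.\<close>

lemma fenchel_conjugate_gradient:
  assumes "convex_on UNIV f" "GDERIV f b :> D"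
  shows "fenchel_conjugate f D = ereal (inner D b - f b)"
proof (rule antisym)
  have "inner D b' - f b' \<le> inner D b - f b" for b'
    using convex_on_gradient_inequality[OF assms, of b'] by (simp add: inner_simps inner_commute)
  then show "fenchel_conjugate f D \<le> ereal (inner D b - f b)"
    unfolding fenchel_conjugate_def by (intro SUP_least) simp
qed (rule fenchel_young)

text \<open>Weak duality: in the Fenchel-Young bound the term \<open>inner l b\<close> absorbs the
  integral of the lower value.\<close>

lemma dual_objective_ge:
  assumes "(\<integral>x. lower_value F g l x \<partial>m) \<le> inner l b"
  shows "ereal (- f b) \<le> dual_objective F g f m l"
proof -
  have "ereal (- f b) \<le> ereal (inner l b - f b) - ereal (\<integral>x. lower_value F g l x \<partial>m)"
    using assms by simp
  also have "\<dots> \<le> dual_objective F g f m l"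
    unfolding dual_objective_def by (intro ereal_minus_mono fenchel_young order_refl)
  finally show ?thesis .
qed

theorem proposition5p2:
  fixes X :: "'x::{banach, second_countable_topology} set"
    and F :: "'x \<Rightarrow> 'y::polish_space set"
    and g :: "'x \<times> 'y \<Rightarrow> 'h::{real_inner, banach, second_countable_topology}"
    and f :: "'h \<Rightarrow> real"
    and m :: "'x measure"
    and L Lg :: real
  assumes X_closed: "closed X"
    and m_prob: "m \<in> borel_probs X"
    and F_nonempty: "\<And>x. x \<in> X \<Longrightarrow> F x \<noteq> {}"
    and F_closed_graph: "closedin (top_of_set (X \<times> UNIV)) (Sigma X F)"
    and g_borel: "g \<in> borel_measurable (restrict_space borel (Sigma X F))"
    and f_borel: "f \<in> borel_measurable borel"
    and g_bounded: "bounded (g ` Sigma X F)"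
    and f_convex: "convex_on UNIV f"
    and f_differentiable: "\<And>b. f differentiable (at b)"
    and gradient_lipschitz: "L-lipschitz_on UNIV (gradient f)"
    and g_lsc: "\<And>l. l \<in> conjugate_domain f \<Longrightarrow> lsc_function_on (Sigma X F) (scalarized g l)"
    and G_lsc: "\<And>l. l \<in> conjugate_domain f \<Longrightarrow>
                  lsc_map_on X (\<lambda>x. {scalarized g l (x, y) | y. y \<in> F x})"
    and BR_nonempty: "\<And>l x. l \<in> conjugate_domain f \<Longrightarrow> x \<in> X \<Longrightarrow> best_responses F g l x \<noteq> {}"
    and g_continuous: "continuous_on (Sigma X F) g"
    and F_compact: "\<And>x. x \<in> X \<Longrightarrow> compact (F x)"
    and F_usc: "usc_map_on X F"
    and Lg_nonneg: "Lg \<ge> 0"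
    and Z_lipschitz: "lipschitz_map_on Lg X (\<lambda>x. {g (x, y) | y. y \<in> F x})"
    and G_closed: "closed (aggregates X F g m)"
  shows "primal_value X F g f m = dual_value F g f m
         \<and> (\<exists>\<mu>. primal_solution X F g f m \<mu>)
         \<and> (\<forall>l \<mu>. dual_solution F g f m l \<and> primal_solution X F g f m \<mu>
               \<longrightarrow> l = gradient f (\<integral>z. g z \<partial>\<mu>))"
proof -
  define K where "K = aggregates X F g m"
  have K_integral: "(\<integral>z. g z \<partial>\<mu>) \<in> K" if "\<mu> \<in> probs_with_marginal X F m" for \<mu>
    using that by (auto simp: K_def aggregates_def)
  have f_gradient: "GDERIV f b :> gradient f b" for b
    by (rule GDERIV_gradient[OF f_differentiable])
  have u_continuous: "continuous_on X (lower_value F g l)" for l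
    by (rule lower_value_continuous[OF F_nonempty g_bounded Lg_nonneg Z_lipschitz])
  have u_le: "(\<integral>x. lower_value F g l x \<partial>m) \<le> inner l b" if "b \<in> K" for l b
    using that integral_lower_value_le[OF F_nonempty g_borel g_bounded u_continuous]
    by (auto simp: K_def aggregates_def)
  \<comment> \<open>Together with \<open>u_le\<close>, the integral of the lower value is the
    minimum of \<open>inner l\<close> over \<open>K\<close>.\<close>
  have u_attained: "\<exists>b\<in>K. inner l b = (\<integral>x. lower_value F g l x \<partial>m)" for l
    using exists_best_response_measure[OF X_closed m_prob F_nonempty F_compact F_usc g_continuous
        g_bounded u_continuous] K_integral by blast
  have K_ne: "K \<noteq> {}" using u_attained by blast
  have K_convex: "convex K" and K_bounded: "bounded K"
    unfolding K_def
    by (rule convex_aggregates[OF m_prob g_borel g_bounded], rule bounded_aggregates[OF g_borel g_bounded])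
  \<comment> \<open>The tangent to \<open>f\<close> at \<open>0\<close> is an affine minorant, and
    it is bounded below on the bounded set \<open>K\<close>.\<close>
  have "bdd_below (f ` K)"
  proof -
    obtain C where C: "\<And>b. b \<in> K \<Longrightarrow> norm b \<le> C"
      using K_bounded by (auto simp: bounded_iff)
    show ?thesis
    proof (rule bdd_belowI2)
      fix b assume "b \<in> K"
      then have "\<bar>inner b (gradient f 0)\<bar> \<le> C * norm (gradient f 0)"
        using Cauchy_Schwarz_ineq2[of b "gradient f 0"] mult_right_mono[OF C, of b "norm (gradient f 0)"]
        by simp
      then show "f 0 - C * norm (gradient f 0) \<le> f b"
        using convex_on_gradient_inequality[OF f_convex f_gradient, of 0 b] by simp
    qed
  qed
  moreover have "continuous_on K f"
    using f_differentiable by (meson continuous_at_imp_continuous_on differentiable_imp_continuous_within)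
  ultimately obtain b where b: "b \<in> K" and b_min: "\<And>b'. b' \<in> K \<Longrightarrow> f b \<le> f b'"
    using convex_continuous_attains_inf[OF G_closed[folded K_def] K_convex K_bounded K_ne]
      convex_on_subset[OF f_convex] K_convex by (metis subset_UNIV)
  define l where "l = gradient f b"
  \<comment> \<open>Case of slope zero: the segment from \<open>b\<close> to \<open>b'\<close> stays
    in \<open>K\<close>, where \<open>f\<close> is at least \<open>f b\<close>.\<close>
  have optimality: "0 \<le> inner (b' - b) l" if b': "b' \<in> K" for b'
  proof (rule GDERIV_ge_linear_lower_bound[where f = f and b = b])
    show "GDERIV f b :> l" unfolding l_def by (rule f_gradient)
    fix t :: real assume "0 < t" "t \<le> 1"
    then have "(1 - t) *\<^sub>R b + t *\<^sub>R b' \<in> K"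
      using K_convex b b' by (intro convexD) auto
    then show "f b + t * 0 \<le> f (b + t *\<^sub>R (b' - b))"
      using b_min by (simp add: algebra_simps)
  qed
  obtain b' where "b' \<in> K" "inner l b' = (\<integral>x. lower_value F g l x \<partial>m)"
    using u_attained by blast
  \<comment> \<open>Optimality gives \<open>inner l b \<le> inner l b'\<close>, while
    \<open>u_le\<close> at \<open>b\<close> gives the reverse, so \<open>b\<close> itself minimizes
    \<open>inner l\<close> over \<open>K\<close>.\<close>
  then have u_l: "(\<integral>x. lower_value F g l x \<partial>m) = inner l b"
    using optimality[of b'] u_le[OF b, of l] by (simp add: inner_simps inner_commute)
  have conj_l: "fenchel_conjugate f l = ereal (inner l b - f b)"
    unfolding l_def by (rule fenchel_conjugate_gradient[OF f_convex f_gradient])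
  then have l_dom: "l \<in> conjugate_domain f"
    by (simp add: conjugate_domain_def)
  \<comment> \<open>The two occurrences of \<open>inner l b\<close> cancel, so the weak duality
    bound is met with equality.\<close>
  have dual_l: "dual_objective F g f m l = ereal (- f b)"
    by (simp add: dual_objective_def conj_l u_l)
  obtain \<mu> where \<mu>: "\<mu> \<in> probs_with_marginal X F m" and b_eq: "b = (\<integral>z. g z \<partial>\<mu>)"
    using b by (auto simp: K_def aggregates_def)
  have "primal_value X F g f m = ereal (f b)"
    unfolding primal_value_def
  proof (rule antisym)
    show "(INF \<mu>\<in>probs_with_marginal X F m. ereal (f (\<integral>z. g z \<partial>\<mu>))) \<le> ereal (f b)"
      using INF_lower[OF \<mu>, of "\<lambda>\<mu>. ereal (f (\<integral>z. g z \<partial>\<mu>))"] by (simp add: b_eq)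
  qed (auto intro!: INF_greatest b_min K_integral)
  moreover have "(INF l\<in>conjugate_domain f. dual_objective F g f m l) = ereal (- f b)"
  proof (rule antisym)
    show "(INF l\<in>conjugate_domain f. dual_objective F g f m l) \<le> ereal (- f b)"
      using INF_lower[OF l_dom, of "dual_objective F g f m"] by (simp add: dual_l)
  qed (intro INF_greatest dual_objective_ge u_le b)
  ultimately have "primal_value X F g f m = dual_value F g f m"
    by (simp add: dual_value_def)
  moreover have "primal_solution X F g f m \<mu>"
    using \<mu> b_min K_integral by (auto simp: primal_solution_def is_arg_min_def b_eq not_less)
  moreover have "l' = gradient f (\<integral>z. g z \<partial>\<nu>)"
    if dual: "dual_solution F g f m l'" and primal: "primal_solution X F g f m \<nu>" for l' \<nu>
  proof (rule subgradient_eq_gradient[OF f_gradient])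
    fix b'
    define c where "c = (\<integral>z. g z \<partial>\<nu>)"
    have \<nu>: "\<nu> \<in> probs_with_marginal X F m" and "f c \<le> f b"
      using primal \<mu> by (auto simp: primal_solution_def is_arg_min_def b_eq c_def not_less)
    have "dual_objective F g f m l' \<le> ereal (- f b)"
      using dual l_dom by (auto simp: dual_solution_def is_arg_min_def not_less dual_l[symmetric])
    \<comment> \<open>Replacing the conjugate by its term at an arbitrary \<open>b'\<close> keeps
      the inequality. Combined with the lower value integral being at most \<open>inner l' c\<close>
      and with \<open>f c \<le> f b\<close>, it becomes the subgradient inequality for
      \<open>l'\<close> at \<open>c\<close>.\<close>
    then have "ereal (- f b) \<ge> ereal (inner l' b' - f b') - ereal (\<integral>x. lower_value F g l' x \<partial>m)"
      unfolding dual_objective_def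
      by (rule order_trans[OF ereal_minus_mono[OF fenchel_young order_refl]])
    then show "f (\<integral>z. g z \<partial>\<nu>) + inner (b' - (\<integral>z. g z \<partial>\<nu>)) l' \<le> f b'"
      using u_le[OF K_integral[OF \<nu>], of l'] \<open>f c \<le> f b\<close>
      by (simp add: c_def[symmetric] inner_simps inner_commute)
  qed
  ultimately show ?thesis by blast
qed

end
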